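(* Let $\mathcal{T}$ be a mesh of $\Omega\subset\mathbb{R}^d$ with vertex set $S$ and let $\mathcal{D}$ be a sizing function with discrepancies $\zeta_K$, all as described in the context. Let $\bm{f}\in[L_2(\Omega)]^d$ be an $L_2$-vector field on $\Omega$. Let $\bm{f}_h$ be the piecewise polynomial interpolation of $\bm{f}$ of degree $\le k$ on $\mathcal{T}$, let $\bm{f}^{\ast}$ be the piecewise polynomial best approximation of $\bm{f}$ of degree $\le k$ over $\mathcal{T}$, and let $\Lambda$ be the Lebesgue constant of the interpolation points. Then $$\big\|\bm{f}-\bm{f}_h\big\|_{L_2(\Omega)}\;\le\;\frac{(1+\Lambda)\,C_3\,\sqrt{\Theta}}{C_1}\;\big\|\bm{f}-\bm{f}^{\ast}\big\|_{L_\infty(\Omega)},$$ where $C_1$ and $C_3$ are constants that depend on the mesh and $\Theta$ is a functional that depends on the mesh, namely $$C_1=\sqrt{\frac{d+1}{2d}}\,\min_{K}\left(\frac{\min_{1\le s\le d+1}\mathrm{dist}\left(\bm{p}_{K,s},\mathrm{aff}(\mathcal{F}_{K,s})\right)}{\Delta(K)}\right),$$ $$C_3=\sqrt{\min\left[\frac12\max_{K}\left(R_{K,\min}\right)^2\left\|\frac{1}{\mathcal{D}^2}\right\|_{2,L_\infty(\Omega)}+\left\|\frac{1}{\mathcal{D}^2}\right\|_{L_\infty(\Omega)}+\max_K|\zeta_K|,\ \frac{1}{\eta^2}\right]},\qquad \Theta=\sum_{K\in\mathcal{T}}\left(\sum_{i=1}^{d+1}\sum_{j=1}^{i-1}(\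bm{p}_{K,ij}\cdot\bm{p}_{K,ij})\,|K|\right).$$
   Context: Points and mesh. $d\ge 1$ is an integer. $S=\{\bm{p}_1,\dots,\bm{p}_{N_v}\}\subset\mathbb{R}^d$ is a finite point set and $\Omega=\mathrm{conv}(S)$ (a bounded, simply-connected $d$-dimensional polytopal domain). $S$ is an $(\varepsilon,\overline{\eta})$-net with $\varepsilon,\eta>0$, $\overline{\eta}=\eta/\varepsilon$: every $\bm{x}\in\Omega$ has some $\bm{p}_l\in S$ with $|\bm{x}-\bm{p}_l|\le\varepsilon$, and $|\bm{p}_l-\bm{p}_n|\ge\eta$ for all distinct $\bm{p}_l,\bm{p}_n\in S$. $\mathcal{T}$ is a triangulation whose vertices are the points of $S$: its elements $K$ are non-overlapping $d$-simplices whose union has the same hypervolume as $\Omega$, forming a pure simplicial $d$-complex, without hanging nodes, that is $d$-connected and in which each $(d-1)$-simplex (facet) has exactly one (boundary) or two (interior) $d$-simplex neighbors. The vertices of $K$ are $\bm{p}_{K,1},\dots,\bm{p}_{K,d+1}$, and $\bm{p}_{K,ij}=\bm{p}_{K,j}-\bm{p}_{K,i}$. $\mathcal{F}_{K,s}$ is the facet of $K$ opposite to $\bm{p}_{K,s}$, $\mathrm{aff}$ denotes affine hull and $\mathrm{dist}$ the shortest (Euclidean) distance. $|K|$ is the $d$-dimensional hypervolume of $K$, $\Delta(K)$ its diameter (longest edge length), and $R_{K,\min}$ its min-containment radius (radius of the smallest ball containing $K$). $\min_K,\max_K$ are over $K\in\mathcal{T}$. Sizing function. $\mathcal{D}:\Omega\to(0,\infty)$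 satisfies $1/\mathcal{D}^2\in C^2(\Omega)$. For each $K$, $\zeta_K\in\mathbb{R}$ is chosen so that $$\min_{1\le i\le d+1}\frac{1}{\mathcal{D}^2(\bm{p}_{K,i})}\le\frac{1}{\Delta(K)^2}+\zeta_K\le\max_{1\le i\le d+1}\frac{1}{\mathcal{D}^2(\bm{p}_{K,i})}.$$ For a $C^2$ function $g$, $\|g\|_{2,L_\infty(\Omega)}$ is the $L_\infty(\Omega)$ norm of $\bm{x}\mapsto\sup_{|\bm{u}_1|\le1,|\bm{u}_2|\le1}\left|\frac{\partial}{\partial\bm{u}_1}\frac{\partial}{\partial\bm{u}_2}g(\bm{x})\right|$, with $\partial/\partial\bm{u}$ the directional derivative. Norms. $[L_2(\Omega)]^d$ is the space of vector fields $\bm{g}:\Omega\to\mathbb{R}^d$ with $\|\bm{g}\|_{L_2(\Omega)}=\left[\int_\Omega\bm{g}\cdot\bm{g}\,dV\right]^{1/2}<\infty$, and $\|\bm{g}\|_{L_\infty(\Omega)}$ is the essential supremum of the Euclidean norm $|\bm{g}(\bm{x})|$ over $\Omega$. Interpolation. Fix a polynomial degree $k$, let $N_p=\frac{(k+d)!}{k!\,d!}$, and let $\bm{\xi}_1,\dots,\bm{\xi}_{N_p}$ be interpolation points in a reference $d$-simplex; $L_1,\dots,L_{N_p}$ are the corresponding multi-dimensional Lagrange polynomials of degree $\le k$, $L_j(\bm{\xi}_m)=1$ if $j=m$ and $0$ otherwise. For each $K$, $\bm{x}\mapsto\bm{\xi}(\bm{x})$ is the (affine) map from $K$ to the reference simplex,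 with inverse $\bm{\xi}\mapsto\bm{x}(\bm{\xi})$, and $\bm{x}_j=\bm{x}(\bm{\xi}_j)\in K$. On $K$, $\bm{f}_h(\bm{x})=\sum_{j=1}^{N_p}\bm{f}(\bm{x}_j)L_j(\bm{\xi}(\bm{x}))$. The Lebesgue constant is $\Lambda=\max_{\bm{\xi}}\sum_{m=1}^{N_p}|L_m(\bm{\xi})|$, maximum over the reference simplex. The best approximation $\bm{f}^{\ast}$ lies in the same piecewise polynomial space as $\bm{f}_h$ and is defined componentwise and elementwise: on each $K$, its $i$-th component is a polynomial of degree $\le k$ minimizing $\|f_i-q\|_{L_\infty(K)}$ over all polynomials $q$ of degree $\le k$, where $f_i$ is the $i$-th component of $\bm{f}$.
   Formalization: Each nodal value f(x_j) is assumed to be an essential value of f on K at x_j (true e.g. if f restricted to K is continuous at x_j); for arbitrary L_2 fields the claim fails, e.g. f = 0 except at one node, where the right side is 0 but f_h is not. *)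

theory Defs
  imports "HOL-Analysis.Analysis" "HOL-Probability.Essential_Supremum"
begin

text \<open>
  Euclidean space of dimension \<open>d\<close> is a type \<open>'a::euclidean_space\<close> with \<open>d = DIM('a)\<close>
  (so \<open>d \<ge> 1\<close>); the Cartesian components of a vector \<open>v\<close> are \<open>v \<bullet> b\<close> for \<open>b \<in> Basis\<close>.
\<close>

section \<open>Point sets and meshes\<close>

text \<open>The normalised separation of the net is \<open>\<eta> / \<epsilon>\<close>; we keep \<open>\<epsilon>\<close> and \<open>\<eta>\<close> as the parameters.\<close>

definition eps_net :: "'a::euclidean_space set \<Rightarrow> real \<Rightarrow> real \<Rightarrow> bool" where
  "eps_net S \<epsilon> \<eta> \<longleftrightarrow>
     finite S \<and> \<epsilon> > 0 \<and> \<eta> > 0 \<and>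
     (\<forall>x \<in> convex hull S. \<exists>v \<in> S. dist x v \<le> \<epsilon>) \<and>
     (\<forall>v \<in> S. \<forall>w \<in> S. v \<noteq> w \<longrightarrow> \<eta> \<le> dist v w)"

definition vertices :: "'a::euclidean_space set \<Rightarrow> 'a set" where
  "vertices K = {v. v extreme_point_of K}"

definition share_facet :: "'a::euclidean_space set \<Rightarrow> 'a set \<Rightarrow> bool" where
  "share_facet K K' \<longleftrightarrow> (\<exists>F. F facet_of K \<and> F facet_of K')"

text \<open>
  A mesh is given by its set of top-dimensional elements; the simplicial complex consists of
  their faces and is therefore pure.  The library predicate \<^const>\<open>triangulation\<close> says that any
  two elements meet in a common face: as all elements have full dimension, distinct elements
  do not overlap, and there are no hanging nodes.  That the complex is \<open>d\<close>-connected means that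
  any two elements are joined by a chain of elements in which neighbours share a facet.
\<close>

definition simplicial_mesh :: "'a::euclidean_space set set \<Rightarrow> 'a set \<Rightarrow> bool" where
  "simplicial_mesh \<T> S \<longleftrightarrow>
     aff_dim S = int DIM('a) \<and>
     triangulation \<T> \<and>
     (\<forall>K \<in> \<T>. int DIM('a) simplex K) \<and>
     (\<Union>K \<in> \<T>. vertices K) = S \<and>
     measure lebesgue (\<Union>\<T>) = measure lebesgue (convex hull S) \<and>
     (\<forall>K \<in> \<T>. \<forall>K' \<in> \<T>. (\<lambda>A B. A \<in> \<T> \<and> B \<in> \<T> \<and> share_facet A B)\<^sup>*\<^sup>* K K') \<and>
     (\<forall>K \<in> \<T>. \<forall>F. F facet_of K \<longrightarrow> card {K' \<in> \<T>. F facet_of K'} \<in> {1, 2})"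

definition vertex_numbering ::
    "'a::euclidean_space set set \<Rightarrow> ('a set \<Rightarrow> nat \<Rightarrow> 'a) \<Rightarrow> bool" where
  "vertex_numbering \<T> p \<longleftrightarrow> (\<forall>K \<in> \<T>. bij_betw (p K) {1..DIM('a) + 1} (vertices K))"

definition edge_vec :: "('a::euclidean_space set \<Rightarrow> nat \<Rightarrow> 'a) \<Rightarrow> 'a set \<Rightarrow> nat \<Rightarrow> nat \<Rightarrow> 'a" where
  "edge_vec p K i j = p K j - p K i"

definition opposite_facet ::
    "('a::euclidean_space set \<Rightarrow> nat \<Rightarrow> 'a) \<Rightarrow> 'a set \<Rightarrow> nat \<Rightarrow> 'a set" where
  "opposite_facet p K s = convex hull (p K ` ({1..DIM('a) + 1} - {s}))"

definition min_containment_radius :: "'a::euclidean_space set \<Rightarrow> real" where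
  "min_containment_radius K = Inf {r. 0 \<le> r \<and> (\<exists>c. K \<subseteq> cball c r)}"


section \<open>Function spaces and norms\<close>

text \<open>
  Norms are extended-valued, so that no finiteness is presupposed.
  Note that \<^const>\<open>esssup\<close> of a non-measurable function is \<open>\<infinity>\<close>.
\<close>

definition linf_norm :: "'a::euclidean_space set \<Rightarrow> ('a \<Rightarrow> 'b::real_normed_vector) \<Rightarrow> ennreal" where
  "linf_norm \<Omega> g = esssup (lebesgue_on \<Omega>) (\<lambda>x. ennreal (norm (g x)))"

definition L2_field :: "'a::euclidean_space set \<Rightarrow> ('a \<Rightarrow> 'a) \<Rightarrow> bool" where
  "L2_field \<Omega> g \<longleftrightarrow>
     g \<in> borel_measurable (lebesgue_on \<Omega>) \<and> integrable (lebesgue_on \<Omega>) (\<lambda>x. g x \<bullet> g x)"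

definition l2_norm :: "'a::euclidean_space set \<Rightarrow> ('a \<Rightarrow> 'a) \<Rightarrow> ennreal" where
  "l2_norm \<Omega> g =
     (if L2_field \<Omega> g then ennreal (sqrt (integral\<^sup>L (lebesgue_on \<Omega>) (\<lambda>x. g x \<bullet> g x))) else \<infinity>)"

text \<open>
  \<open>\<Omega>\<close> is closed; at boundary points the derivatives are taken within \<open>\<Omega>\<close>, i.e. a function in
  \<open>C\<^sup>2(\<Omega>)\<close> is twice continuously differentiable up to the boundary.
\<close>

definition C2_on :: "'a::euclidean_space set \<Rightarrow> ('a \<Rightarrow> real) \<Rightarrow> bool" where
  "C2_on \<Omega> g \<longleftrightarrow>
     (\<exists>(g' :: 'a \<Rightarrow> 'a \<Rightarrow>\<^sub>L real) (g'' :: 'a \<Rightarrow> 'a \<Rightarrow>\<^sub>L 'a \<Rightarrow>\<^sub>L real).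
        (\<forall>x \<in> \<Omega>. (g has_derivative blinfun_apply (g' x)) (at x within \<Omega>)) \<and>
        (\<forall>x \<in> \<Omega>. (g' has_derivative blinfun_apply (g'' x)) (at x within \<Omega>)) \<and>
        continuous_on \<Omega> g'')"

definition dir_deriv :: "'a::euclidean_space \<Rightarrow> ('a \<Rightarrow> real) \<Rightarrow> 'a \<Rightarrow> real" where
  "dir_deriv u g x = deriv (\<lambda>t. g (x + t *\<^sub>R u)) 0"

text \<open>
  The two-sided directional derivatives below are meaningful in the interior of \<open>\<Omega>\<close> only; for
  convex \<open>\<Omega>\<close> the boundary is a null set and does not affect the essential supremum.
\<close>

definition C2_seminorm :: "'a::euclidean_space set \<Rightarrow> ('a \<Rightarrow> real) \<Rightarrow> ennreal" where
  "C2_seminorm \<Omega> g =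
     esssup (lebesgue_on \<Omega>)
       (\<lambda>x. SUP u1 \<in> cball 0 1. SUP u2 \<in> cball 0 1. ennreal \<bar>dir_deriv u1 (dir_deriv u2 g) x\<bar>)"

definition sizing_function :: "'a::euclidean_space set \<Rightarrow> ('a \<Rightarrow> real) \<Rightarrow> bool" where
  "sizing_function \<Omega> D \<longleftrightarrow> (\<forall>x \<in> \<Omega>. D x > 0) \<and> C2_on \<Omega> (\<lambda>x. 1 / (D x)\<^sup>2)"

definition sizing_discrepancy ::
    "'a::euclidean_space set set \<Rightarrow> ('a set \<Rightarrow> nat \<Rightarrow> 'a) \<Rightarrow> ('a \<Rightarrow> real) \<Rightarrow> ('a set \<Rightarrow> real) \<Rightarrow> bool"
  where
  "sizing_discrepancy \<T> p D \<zeta> \<longleftrightarrow>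
     (\<forall>K \<in> \<T>.
        Min ((\<lambda>i. 1 / (D (p K i))\<^sup>2) ` {1..DIM('a) + 1}) \<le> 1 / (diameter K)\<^sup>2 + \<zeta> K \<and>
        1 / (diameter K)\<^sup>2 + \<zeta> K \<le> Max ((\<lambda>i. 1 / (D (p K i))\<^sup>2) ` {1..DIM('a) + 1}))"


section \<open>Polynomials, interpolation and best approximation\<close>

definition multi_indices :: "nat \<Rightarrow> ('a::euclidean_space \<Rightarrow> nat) set" where
  "multi_indices k = {\<alpha>. (\<forall>b. b \<notin> Basis \<longrightarrow> \<alpha> b = 0) \<and> (\<Sum>b\<in>Basis. \<alpha> b) \<le> k}"

lemma finite_multi_indices: "finite (multi_indices k :: ('a::euclidean_space \<Rightarrow> nat) set)"
proof (rule finite_subset)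
  show "(multi_indices k :: ('a \<Rightarrow> nat) set)
          \<subseteq> {\<alpha>. \<forall>b. (b \<in> Basis \<longrightarrow> \<alpha> b \<in> {..k}) \<and> (b \<notin> Basis \<longrightarrow> \<alpha> b = 0)}"
  proof (intro subsetI CollectI allI conjI impI)
    fix \<alpha> :: "'a \<Rightarrow> nat" and b :: 'a
    assume \<alpha>: "\<alpha> \<in> multi_indices k"
    show "\<alpha> b \<in> {..k}" if "b \<in> Basis"
      using \<alpha> member_le_sum[of b Basis \<alpha>] that by (simp add: multi_indices_def)
    show "\<alpha> b = 0" if "b \<notin> Basis"
      using \<alpha> that by (simp add: multi_indices_def)
  qed
  show "finite {\<alpha> :: 'a \<Rightarrow> nat. \<forall>b. (b \<in> Basis \<longrightarrow> \<alpha> b \<in> {..k}) \<and> (b \<notin> Basis \<longrightarrow> \<alpha> b = 0)}"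
    by (rule finite_set_of_finite_funs) simp_all
qed

definition poly_deg_le :: "nat \<Rightarrow> ('a::euclidean_space \<Rightarrow> real) \<Rightarrow> bool" where
  "poly_deg_le k q \<longleftrightarrow>
     (\<exists>c. \<forall>x. q x = (\<Sum>\<alpha>\<in>multi_indices k. c \<alpha> * (\<Prod>b\<in>Basis. (x \<bullet> b) ^ \<alpha> b)))"

definition num_nodes :: "nat \<Rightarrow> nat \<Rightarrow> nat" where
  "num_nodes k d = fact (k + d) div (fact k * fact d)"

text \<open>
  \<open>Kref\<close> is the reference simplex, \<open>\<xi> 1, \<dots>, \<xi> N\<close> are the interpolation points and
  \<open>L 1, \<dots>, L N\<close> the corresponding Lagrange polynomials, where \<open>N = num_nodes k DIM('a)\<close>.
\<close>

definition lagrange_basis ::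
    "nat \<Rightarrow> 'a::euclidean_space set \<Rightarrow> (nat \<Rightarrow> 'a) \<Rightarrow> (nat \<Rightarrow> 'a \<Rightarrow> real) \<Rightarrow> bool" where
  "lagrange_basis k Kref \<xi> L \<longleftrightarrow>
     int DIM('a) simplex Kref \<and>
     (\<forall>j \<in> {1..num_nodes k DIM('a)}. \<xi> j \<in> Kref \<and> poly_deg_le k (L j)) \<and>
     (\<forall>j \<in> {1..num_nodes k DIM('a)}. \<forall>m \<in> {1..num_nodes k DIM('a)}.
        L j (\<xi> m) = (if j = m then 1 else 0))"

definition lebesgue_constant :: "nat \<Rightarrow> 'a::euclidean_space set \<Rightarrow> (nat \<Rightarrow> 'a \<Rightarrow> real) \<Rightarrow> real" where
  "lebesgue_constant k Kref L = (SUP y \<in> Kref. \<Sum>m = 1..num_nodes k DIM('a). \<bar>L m y\<bar>)"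

text \<open>\<open>X K\<close> is the affine map taking the element \<open>K\<close> onto the reference simplex.\<close>

definition reference_maps ::
    "'a::euclidean_space set set \<Rightarrow> 'a set \<Rightarrow> ('a set \<Rightarrow> 'a \<Rightarrow> 'a) \<Rightarrow> bool" where
  "reference_maps \<T> Kref X \<longleftrightarrow>
     (\<forall>K \<in> \<T>. (\<exists>A b. linear A \<and> (\<forall>x. X K x = A x + b)) \<and> bij (X K) \<and> X K ` K = Kref)"

definition node ::
    "('a::euclidean_space set \<Rightarrow> 'a \<Rightarrow> 'a) \<Rightarrow> (nat \<Rightarrow> 'a) \<Rightarrow> 'a set \<Rightarrow> nat \<Rightarrow> 'a" where
  "node X \<xi> K j = inv (X K) (\<xi> j)"

text \<open>
  A piecewise polynomial may take different values on the two sides of a facet, so it is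
  prescribed on the interiors of the elements only; its values on the null set of facets
  are arbitrary.
\<close>

definition piecewise_interpolant ::
    "nat \<Rightarrow> 'a::euclidean_space set set \<Rightarrow> ('a set \<Rightarrow> 'a \<Rightarrow> 'a) \<Rightarrow> (nat \<Rightarrow> 'a) \<Rightarrow>
     (nat \<Rightarrow> 'a \<Rightarrow> real) \<Rightarrow> ('a \<Rightarrow> 'a) \<Rightarrow> ('a \<Rightarrow> 'a) \<Rightarrow> bool" where
  "piecewise_interpolant k \<T> X \<xi> L f fh \<longleftrightarrow>
     (\<forall>K \<in> \<T>. \<forall>x \<in> interior K.
        fh x = (\<Sum>j = 1..num_nodes k DIM('a). L j (X K x) *\<^sub>R f (node X \<xi> K j)))"

definition piecewise_best_approximation ::
    "nat \<Rightarrow> 'a::euclidean_space set set \<Rightarrow> ('a \<Rightarrow> 'a) \<Rightarrow> ('a \<Rightarrow> 'a) \<Rightarrow> bool" where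
  "piecewise_best_approximation k \<T> f fs \<longleftrightarrow>
     (\<forall>K \<in> \<T>. \<forall>b \<in> Basis. \<exists>q.
        poly_deg_le k q \<and>
        (\<forall>x \<in> interior K. fs x \<bullet> b = q x) \<and>
        (\<forall>r. poly_deg_le k r \<longrightarrow>
           linf_norm K (\<lambda>x. f x \<bullet> b - q x) \<le> linf_norm K (\<lambda>x. f x \<bullet> b - r x)))"

text \<open>
  Nodal interpolation uses point values, which are not determined by the class of a field modulo
  null sets.  The value \<open>f x\<close> is compatible with \<open>f\<close> as an almost-everywhere defined field on
  the element \<open>K\<close> if it is an essential value: arbitrarily close to \<open>x\<close>, \<open>f\<close> comes arbitrarily close
  to \<open>f x\<close> on a non-null subset of \<open>K\<close>.  This holds wherever \<open>f\<close> is continuous within \<open>K\<close>.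
\<close>

definition essential_value_at ::
    "'a::euclidean_space set \<Rightarrow> ('a \<Rightarrow> 'b::metric_space) \<Rightarrow> 'a \<Rightarrow> bool" where
  "essential_value_at K f x \<longleftrightarrow>
     (\<forall>e > 0. \<not> negligible {y \<in> K \<inter> ball x e. dist (f y) (f x) < e})"

lemma essential_value_at_continuous:
  assumes "continuous (at x within K) f" "x \<in> K" "convex K" "interior K \<noteq> {}"
  shows "essential_value_at K f x"
  unfolding essential_value_at_def
proof (intro allI impI notI)
  fix e :: real
  assume e: "e > 0" and neg: "negligible {y \<in> K \<inter> ball x e. dist (f y) (f x) < e}"
  obtain r where r: "r > 0" "\<And>y. y \<in> K \<Longrightarrow> dist y x < r \<Longrightarrow> dist (f y) (f x) < e"
    using assms(1) e unfolding continuous_within_eps_delta by blast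
  let ?U = "interior K \<inter> ball x (min e r)"
  have "x \<in> closure (interior K)"
    using assms convex_closure_interior closure_subset by blast
  moreover have "x \<in> ball x (min e r)" using e r(1) by simp
  ultimately have "?U \<noteq> {}"
    using open_Int_closure_eq_empty[of "ball x (min e r)" "interior K"]
    by (metis IntI empty_iff inf_commute open_ball)
  moreover have "?U \<subseteq> {y \<in> K \<inter> ball x e. dist (f y) (f x) < e}"
    using r(2) interior_subset[of K] by (auto simp: dist_commute)
  ultimately show False
    using neg negligible_subset open_not_negligible[of ?U] by blast
qed


section \<open>Mesh-dependent quantities\<close>

definition C1_const :: "'a::euclidean_space set set \<Rightarrow> ('a set \<Rightarrow> nat \<Rightarrow> 'a) \<Rightarrow> real" where
  "C1_const \<T> p =
     sqrt ((real DIM('a) + 1) / (2 * real DIM('a))) *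
     Min ((\<lambda>K. Min ((\<lambda>s. infdist (p K s) (affine hull (opposite_facet p K s))) ` {1..DIM('a) + 1})
               / diameter K) ` \<T>)"

text \<open>The minimum is at most \<open>1 / \<eta>\<^sup>2\<close>, hence finite, so \<^const>\<open>enn2real\<close> loses nothing.\<close>

definition C3_const ::
    "'a::euclidean_space set \<Rightarrow> 'a set set \<Rightarrow> real \<Rightarrow> ('a \<Rightarrow> real) \<Rightarrow> ('a set \<Rightarrow> real) \<Rightarrow> real" where
  "C3_const \<Omega> \<T> \<eta> D \<zeta> =
     sqrt (enn2real (min
       (ennreal (1 / 2 * Max ((\<lambda>K. (min_containment_radius K)\<^sup>2) ` \<T>))
            * C2_seminorm \<Omega> (\<lambda>x. 1 / (D x)\<^sup>2)
          + linf_norm \<Omega> (\<lambda>x. 1 / (D x)\<^sup>2)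
          + ennreal (Max ((\<lambda>K. \<bar>\<zeta> K\<bar>) ` \<T>)))
       (ennreal (1 / \<eta>\<^sup>2))))"

definition Theta :: "'a::euclidean_space set set \<Rightarrow> ('a set \<Rightarrow> nat \<Rightarrow> 'a) \<Rightarrow> real" where
  "Theta \<T> p =
     (\<Sum>K\<in>\<T>. (\<Sum>i = 1..DIM('a) + 1. \<Sum>j\<in>{1..<i}. edge_vec p K i j \<bullet> edge_vec p K i j)
             * measure lebesgue K)"

end

theory Submission
  imports Defs "HOL-Library.Function_Algebras"
begin

text \<open>
  The estimate has an analytic and a geometric half.

  The analytic half is Lebesgue's lemma.  On an element \<open>K\<close> the piecewise polynomial \<open>fs\<close> coincides
  with a polynomial field \<open>Q\<close>, which interpolation reproduces (\<open>lagrange_expansion\<close>).  Hence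
  \<open>f - fh\<close> is \<open>f - Q\<close> minus the interpolant of \<open>f - Q\<close>, and at most \<open>1 + \<Lambda>\<close> times the larger of the
  essential supremum \<open>M\<close> of \<open>\<bar>f - fs\<bar>\<close> and the values of \<open>\<bar>f - Q\<bar>\<close> at the nodes.  The latter are bounded
  by \<open>M\<close> as well, since the nodal values of \<open>f\<close> are essential values (\<open>essential_value_norm_le\<close>).
  So \<open>\<bar>f - fh\<bar> \<le> (1 + \<Lambda>) M\<close> almost everywhere on \<open>\<Omega>\<close>, and integration of the square gives
  \<open>sqrt \<bar>\<Omega>\<bar> (1 + \<Lambda>) M\<close> as a bound for the \<open>L\<^sub>2\<close> norm.

  The geometric half is \<open>sqrt \<bar>\<Omega>\<bar> \<le> C\<^sub>3 sqrt \<Theta> / C\<^sub>1\<close>.  Let \<open>h\<close> be the least height of an element \<open>K\<close>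
  and \<open>\<Delta>\<close> its diameter.  Then \<open>C\<^sub>1 \<le> h / \<Delta>\<close> because its dimensional factor is at most one, and \<open>1 / \<Delta> \<le> C\<^sub>3\<close>
  (\<open>inverse_diameter_le_C3_const\<close>): the diameter is at least \<open>\<eta>\<close>, and the condition on \<open>\<zeta>\<close> bounds
  \<open>1 / \<Delta>\<^sup>2\<close> by the value of \<open>1 / D\<^sup>2\<close> at a vertex plus \<open>\<bar>\<zeta> K\<bar>\<close>.  Since an edge is at least as long
  as \<open>h\<close>, it follows that \<open>C\<^sub>1\<^sup>2 \<le> C\<^sub>3\<^sup>2 h\<^sup>2\<close> is at most \<open>C\<^sub>3\<^sup>2\<close> times the sum of the squared edge
  lengths of \<open>K\<close>.  Multiplying by \<open>\<bar>K\<bar>\<close> and summing over the mesh gives \<open>C\<^sub>1\<^sup>2 \<bar>\<Omega>\<bar> \<le> C\<^sub>3\<^sup>2 \<Theta>\<close>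
  (\<open>volume_le_Theta\<close>).
\<close>

section \<open>Polynomials of bounded degree\<close>

lemma poly_deg_le_monomial:
  assumes "\<alpha> \<in> multi_indices k"
  shows "poly_deg_le k (\<lambda>x::'a::euclidean_space. \<Prod>b\<in>Basis. (x \<bullet> b) ^ \<alpha> b)"
  unfolding poly_deg_le_def
proof (intro exI allI)
  fix x :: 'a
  show "(\<Prod>b\<in>Basis. (x \<bullet> b) ^ \<alpha> b)
      = (\<Sum>\<beta>\<in>multi_indices k. (if \<beta> = \<alpha> then 1 else 0) * (\<Prod>b\<in>Basis. (x \<bullet> b) ^ \<beta> b))"
    using assms finite_multi_indices[of k]
    by (subst sum.remove[of _ \<alpha>]) auto
qed

lemma poly_deg_le_cmult:
  assumes "poly_deg_le k q"
  shows "poly_deg_le k (\<lambda>x. c * q x)"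
proof -
  obtain u where "\<And>x. q x = (\<Sum>\<alpha>\<in>multi_indices k. u \<alpha> * (\<Prod>b\<in>Basis. (x \<bullet> b) ^ \<alpha> b))"
    using assms unfolding poly_deg_le_def by blast
  then show ?thesis
    unfolding poly_deg_le_def
    by (intro exI[of _ "\<lambda>\<alpha>. c * u \<alpha>"]) (simp add: sum_distrib_left mult.assoc)
qed

lemma poly_deg_le_add:
  assumes "poly_deg_le k q" "poly_deg_le k r"
  shows "poly_deg_le k (\<lambda>x. q x + r x)"
proof -
  obtain u where "\<And>x. q x = (\<Sum>\<alpha>\<in>multi_indices k. u \<alpha> * (\<Prod>b\<in>Basis. (x \<bullet> b) ^ \<alpha> b))"
    using assms(1) unfolding poly_deg_le_def by blast
  moreover obtain v where "\<And>x. r x = (\<Sum>\<alpha>\<in>multi_indices k. v \<alpha> * (\<Prod>b\<in>Basis. (x \<bullet> b) ^ \<alpha> b))"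
    using assms(2) unfolding poly_deg_le_def by blast
  ultimately show ?thesis
    unfolding poly_deg_le_def
    by (intro exI[of _ "\<lambda>\<alpha>. u \<alpha> + v \<alpha>"]) (simp add: sum.distrib distrib_right)
qed

lemma poly_deg_le_zero: "poly_deg_le k (\<lambda>x. 0)"
  unfolding poly_deg_le_def by (intro exI[of _ "\<lambda>_. 0"]) simp

lemma poly_deg_le_sum:
  assumes "\<And>i. i \<in> I \<Longrightarrow> poly_deg_le k (q i)"
  shows "poly_deg_le k (\<lambda>x. \<Sum>i\<in>I. q i x)"
  using assms
  by (induction I rule: infinite_finite_induct) (auto intro: poly_deg_le_zero poly_deg_le_add)

lemma poly_deg_le_mono:
  assumes "poly_deg_le j q" "j \<le> k"
  shows "poly_deg_le k q"
proof -
  obtain u where u: "q = (\<lambda>x. \<Sum>\<alpha>\<in>multi_indices j. u \<alpha> * (\<Prod>b\<in>Basis. (x \<bullet> b) ^ \<alpha> b))"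
    using assms(1) unfolding poly_deg_le_def by blast
  show ?thesis
    unfolding u using assms(2)
    by (intro poly_deg_le_sum poly_deg_le_cmult poly_deg_le_monomial) (auto simp: multi_indices_def)
qed

lemma poly_deg_le_mult:
  assumes "poly_deg_le j q" "poly_deg_le k r"
  shows "poly_deg_le (j + k) (\<lambda>x::'a::euclidean_space. q x * r x)"
proof -
  obtain u where u: "q = (\<lambda>x. \<Sum>\<alpha>\<in>multi_indices j. u \<alpha> * (\<Prod>b\<in>Basis. (x \<bullet> b) ^ \<alpha> b))"
    using assms(1) unfolding poly_deg_le_def by blast
  obtain v where v: "r = (\<lambda>x. \<Sum>\<beta>\<in>multi_indices k. v \<beta> * (\<Prod>b\<in>Basis. (x \<bullet> b) ^ \<beta> b))"
    using assms(2) unfolding poly_deg_le_def by blast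
  have "(\<lambda>x. q x * r x) = (\<lambda>x. \<Sum>\<alpha>\<in>multi_indices j. \<Sum>\<beta>\<in>multi_indices k.
          (u \<alpha> * v \<beta>) * (\<Prod>b\<in>Basis. (x \<bullet> b) ^ (\<alpha> b + \<beta> b)))"
    unfolding u v by (simp add: sum_product power_add prod.distrib mult_ac)
  moreover have "poly_deg_le (j + k) \<dots>"
    by (intro poly_deg_le_sum poly_deg_le_cmult poly_deg_le_monomial)
       (auto simp: multi_indices_def sum.distrib add_mono)
  ultimately show ?thesis by simp
qed

lemma poly_deg_le_const: "poly_deg_le k (\<lambda>x::'a::euclidean_space. c)"
proof -
  have "(\<lambda>_. 0) \<in> (multi_indices k :: ('a \<Rightarrow> nat) set)"
    by (simp add: multi_indices_def)
  from poly_deg_le_cmult[OF poly_deg_le_monomial[OF this], of c] show ?thesis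
    by simp
qed

lemma poly_deg_le_coordinate:
  assumes "b \<in> Basis"
  shows "poly_deg_le 1 (\<lambda>x::'a::euclidean_space. x \<bullet> b)"
proof -
  have "(\<lambda>c. if c = b then 1 else 0) \<in> (multi_indices 1 :: ('a \<Rightarrow> nat) set)"
    using assms by (auto simp: multi_indices_def)
  moreover have "(\<Prod>c\<in>Basis. (x \<bullet> c) ^ (if c = b then 1 else 0)) = x \<bullet> b" for x :: 'a
    using assms by (subst prod.remove[of _ b]) auto
  ultimately show ?thesis
    using poly_deg_le_monomial by fastforce
qed

lemma poly_deg_le_power:
  assumes "poly_deg_le k q"
  shows "poly_deg_le (k * n) (\<lambda>x. q x ^ n)"
  using assms
  by (induction n) (auto intro: poly_deg_le_const poly_deg_le_mult)

lemma poly_deg_le_prod: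
  assumes "\<And>i. i \<in> I \<Longrightarrow> poly_deg_le (m i) (q i)"
  shows "poly_deg_le (\<Sum>i\<in>I. m i) (\<lambda>x. \<Prod>i\<in>I. q i x)"
  using assms
  by (induction I rule: infinite_finite_induct) (auto intro: poly_deg_le_const poly_deg_le_mult)

text \<open>
  Every coordinate of an affine map is a polynomial of degree at most one, so substituting it
  for a variable does not raise the degree of a monomial.  This carries the Lagrange basis of
  the reference simplex over to the elements of a mesh.
\<close>
lemma poly_deg_le_compose_affine:
  fixes A :: "'a::euclidean_space \<Rightarrow> 'a"
  assumes "linear A" "poly_deg_le k q"
  shows "poly_deg_le k (\<lambda>x. q (A x + t))"
proof -
  obtain u where u: "q = (\<lambda>x. \<Sum>\<alpha>\<in>multi_indices k. u \<alpha> * (\<Prod>b\<in>Basis. (x \<bullet> b) ^ \<alpha> b))"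
    using assms(2) unfolding poly_deg_le_def by blast
  have lin: "poly_deg_le 1 (\<lambda>x. (A x + t) \<bullet> b)" for b
  proof -
    have "(\<lambda>x. (A x + t) \<bullet> b) = (\<lambda>x. (\<Sum>c\<in>Basis. (A c \<bullet> b) * (x \<bullet> c)) + t \<bullet> b)"
    proof
      fix x
      have "A x = A (\<Sum>c\<in>Basis. (x \<bullet> c) *\<^sub>R c)"
        by (simp add: euclidean_representation)
      also have "\<dots> = (\<Sum>c\<in>Basis. (x \<bullet> c) *\<^sub>R A c)"
        using assms(1) by (simp add: linear_sum linear_scale)
      finally show "(A x + t) \<bullet> b = (\<Sum>c\<in>Basis. (A c \<bullet> b) * (x \<bullet> c)) + t \<bullet> b"
        by (simp add: inner_sum_left inner_add_left mult.commute)
    qed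
    then show ?thesis
      by (auto intro!: poly_deg_le_add poly_deg_le_sum poly_deg_le_cmult
            poly_deg_le_coordinate[unfolded One_nat_def] poly_deg_le_const)
  qed
  have "poly_deg_le k (\<lambda>x. \<Prod>b\<in>Basis. ((A x + t) \<bullet> b) ^ \<alpha> b)" if "\<alpha> \<in> multi_indices k" for \<alpha>
  proof (rule poly_deg_le_mono)
    show "poly_deg_le (\<Sum>b\<in>Basis. 1 * \<alpha> b) (\<lambda>x. \<Prod>b\<in>Basis. ((A x + t) \<bullet> b) ^ \<alpha> b)"
      by (intro poly_deg_le_prod poly_deg_le_power lin)
    show "(\<Sum>b\<in>Basis. 1 * \<alpha> b) \<le> k"
      using that by (simp add: multi_indices_def)
  qed
  then show ?thesis
    unfolding u by (intro poly_deg_le_sum poly_deg_le_cmult)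
qed

lemma continuous_on_poly_deg_le:
  assumes "poly_deg_le k q"
  shows "continuous_on A q"
proof -
  obtain u where u: "q = (\<lambda>x. \<Sum>\<alpha>\<in>multi_indices k. u \<alpha> * (\<Prod>b\<in>Basis. (x \<bullet> b) ^ \<alpha> b))"
    using assms unfolding poly_deg_le_def by blast
  show ?thesis
    unfolding u by (intro continuous_intros)
qed

section \<open>Unisolvence of Lagrange interpolation\<close>

text \<open>
  Adding a point to a set of \<open>n\<close> points and splitting off the value \<open>i\<close> there turns the count into
  the diagonal sum \<open>\<Sum>i\<le>k. (n + i choose i) = (n + 1 + k choose k)\<close>.
\<close>
lemma card_bounded_compositions:
  assumes "finite B"
  shows "card {\<alpha> :: 'b \<Rightarrow> nat. (\<forall>b. b \<notin> B \<longrightarrow> \<alpha> b = 0) \<and> (\<Sum>b\<in>B. \<alpha> b) \<le> k} = (k + card B) choose k"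
    (is "card (?M B k) = _")
  using assms
proof (induction B arbitrary: k)
  case empty
  have "?M {} k = {\<lambda>_. 0}"
    by auto
  then show ?case by simp
next
  case (insert a B)
  have fin: "finite (?M B m)" for m
    by (rule card_ge_0_finite) (simp add: insert.IH)
  have upd: "sum (\<alpha>(a := i)) B = sum \<alpha> B" for \<alpha> :: "'b \<Rightarrow> nat" and i
    using insert.hyps(2) by (intro sum.cong) auto
  have "?M (insert a B) k = (\<Union>i\<in>{..k}. (\<lambda>\<alpha>. \<alpha>(a := i)) ` ?M B (k - i))"
    (is "?L = ?R")
  proof (intro equalityI subsetI)
    fix \<alpha> assume \<alpha>: "\<alpha> \<in> ?L"
    then have "\<alpha>(a := 0) \<in> ?M B (k - \<alpha> a)" "\<alpha> a \<in> {..k}"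
      using insert.hyps upd[of \<alpha> 0] by auto
    moreover have "\<alpha> = (\<alpha>(a := 0))(a := \<alpha> a)" by simp
    ultimately show "\<alpha> \<in> ?R" by blast
  next
    fix \<alpha> assume "\<alpha> \<in> ?R"
    then obtain i \<beta> where "i \<le> k" "\<alpha> = \<beta>(a := i)" "\<beta> \<in> ?M B (k - i)"
      by blast
    moreover from this have "sum \<alpha> (insert a B) = i + sum \<beta> B"
      using insert.hyps upd[of \<beta> i] by simp
    ultimately show "\<alpha> \<in> ?L"
      by auto
  qed
  also have "card \<dots> = (\<Sum>i\<le>k. card ((\<lambda>\<alpha>. \<alpha>(a := i)) ` ?M B (k - i)))"
    using fin by (intro card_UN_disjoint) (auto dest: fun_cong[where x = a])
  also have "\<dots> = (\<Sum>i\<le>k. card (?M B (k - i)))"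
  proof (intro sum.cong card_image refl inj_onI ext)
    fix i \<alpha> \<beta> b
    assume "\<alpha> \<in> ?M B (k - i)" "\<beta> \<in> ?M B (k - i)" "\<alpha>(a := i) = \<beta>(a := i)"
    then show "\<alpha> b = \<beta> b"
      using insert.hyps(2) by (cases "b = a") (auto dest: fun_cong[where x = b])
  qed
  also have "\<dots> = (\<Sum>i\<le>k. (card B + (k - i)) choose (k - i))"
    by (simp add: insert.IH add.commute)
  also have "\<dots> = (\<Sum>i\<le>k. (card B + i) choose i)"
    by (rule sum.reindex_bij_witness[of _ "\<lambda>i. k - i" "\<lambda>i. k - i"]) auto
  also have "\<dots> = (k + card (insert a B)) choose k"
    using insert.hyps sum_choose_lower[of "card B" k] by (simp add: add.commute)
  finally show ?case .
qed

lemma card_multi_indices: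
  "card (multi_indices k :: ('a::euclidean_space \<Rightarrow> nat) set) = num_nodes k DIM('a)"
proof -
  have "num_nodes k DIM('a) = (k + DIM('a)) choose k"
    using binomial_fact_lemma[of k "k + DIM('a)"]
    by (simp add: num_nodes_def) (metis fact_nonzero mult_is_0 nonzero_mult_div_cancel_left)
  then show ?thesis
    unfolding multi_indices_def by (simp add: card_bounded_compositions)
qed

text \<open>
  Real functions form a vector space; with this structure the counting argument for unisolvence
  is the comparison of an independent set with a spanning set.
\<close>
interpretation real_fun: vector_space "\<lambda>(c::real) (g::'b \<Rightarrow> real) x. c * g x"
  by unfold_locales (auto simp: fun_eq_iff algebra_simps)

lemma sum_fun_apply: "(\<Sum>i\<in>I. g i) x = (\<Sum>i\<in>I. g i x :: real)"
  by (induction I rule: infinite_finite_induct) auto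

lemma poly_deg_le_imp_span:
  assumes "poly_deg_le k q"
  shows "q \<in> real_fun.span ((\<lambda>\<alpha> x. \<Prod>b\<in>Basis. (x \<bullet> b) ^ \<alpha> b) ` multi_indices k)"
proof -
  obtain u where "\<And>x. q x = (\<Sum>\<alpha>\<in>multi_indices k. u \<alpha> * (\<Prod>b\<in>Basis. (x \<bullet> b) ^ \<alpha> b))"
    using assms unfolding poly_deg_le_def by blast
  then have "q = (\<Sum>\<alpha>\<in>multi_indices k. (\<lambda>x. u \<alpha> * (\<Prod>b\<in>Basis. (x \<bullet> b) ^ \<alpha> b)))"
    by (simp add: fun_eq_iff sum_fun_apply)
  also have "\<dots> \<in> real_fun.span ((\<lambda>\<alpha> x. \<Prod>b\<in>Basis. (x \<bullet> b) ^ \<alpha> b) ` multi_indices k)"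
    by (intro real_fun.span_sum real_fun.span_scale real_fun.span_base) auto
  finally show ?thesis .
qed

text \<open>
  Unisolvence.  Duality with the nodes makes the \<open>l j\<close> linearly independent, and there are as many
  of them as monomials spanning the polynomials of degree at most \<open>k\<close>.  A polynomial outside their
  span could be added to them, giving an independent set larger than that spanning set.  So \<open>q\<close> is a
  combination of the \<open>l j\<close>, and evaluation at the nodes reads off its coefficients.
\<close>
lemma lagrange_expansion:
  fixes q :: "'a::euclidean_space \<Rightarrow> real" and k :: nat
  defines "N \<equiv> num_nodes k DIM('a)"
  assumes deg: "\<And>j. j \<in> {1..N} \<Longrightarrow> poly_deg_le k (l j)"
    and dual: "\<And>j m. j \<in> {1..N} \<Longrightarrow> m \<in> {1..N} \<Longrightarrow> l j (z m) = (if j = m then 1 else 0)"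
    and q: "poly_deg_le k q"
  shows "q x = (\<Sum>j = 1..N. l j x * q (z j))"
proof -
  let ?M = "(\<lambda>\<alpha> x::'a. \<Prod>b\<in>Basis. (x \<bullet> b) ^ \<alpha> b) ` multi_indices k"
  let ?B = "l ` {1..N}"
  have inj: "inj_on l {1..N}"
    by (rule inj_onI) (metis dual zero_neq_one)
  have nodal: "(\<Sum>g\<in>?B. w g * g (z m)) = w (l m)" if "m \<in> {1..N}" for w m
  proof -
    have "(\<Sum>g\<in>?B. w g * g (z m)) = (\<Sum>j\<in>{1..N}. w (l j) * l j (z m))"
      using inj by (simp add: sum.reindex)
    also have "\<dots> = (\<Sum>j\<in>{1..N}. if j = m then w (l j) else 0)"
      using that dual by (intro sum.cong) auto
    finally show ?thesis using that by simp
  qed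
  have indep: "real_fun.independent ?B"
  proof
    assume "real_fun.dependent ?B"
    then obtain w m where w: "m \<in> {1..N}" "w (l m) \<noteq> 0" "(\<Sum>g\<in>?B. (\<lambda>x. w g * g x)) = 0"
      using real_fun.dependent_finite[of ?B] by auto
    have "(\<Sum>g\<in>?B. w g * g (z m)) = 0"
      using fun_cong[OF w(3), of "z m"] by (simp add: sum_fun_apply)
    with nodal[OF w(1), of w] w(2) show False by simp
  qed
  have "q \<in> real_fun.span ?B"
  proof (rule ccontr)
    assume out: "q \<notin> real_fun.span ?B"
    then have "real_fun.independent (insert q ?B)"
      using indep real_fun.independent_insertI by blast
    moreover have "insert q ?B \<subseteq> real_fun.span ?M"
      using deg q poly_deg_le_imp_span by blast
    ultimately have "card (insert q ?B) \<le> card ?M"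
      using real_fun.independent_span_bound[of ?M "insert q ?B"] finite_multi_indices by blast
    also have "\<dots> \<le> N"
      using card_image_le[OF finite_multi_indices[of k], of "\<lambda>\<alpha> x::'a. \<Prod>b\<in>Basis. (x \<bullet> b) ^ \<alpha> b"]
        card_multi_indices[where 'a = 'a, of k] N_def by simp
    also have "\<dots> < card (insert q ?B)"
      using out card_image[OF inj] real_fun.span_base[of q ?B] by (subst card_insert_disjoint) auto
    finally show False by simp
  qed
  then obtain w where w: "q = (\<Sum>g\<in>?B. (\<lambda>x. w g * g x))"
    using real_fun.span_finite[of ?B] by auto
  then have q_eq: "q y = (\<Sum>g\<in>?B. w g * g y)" for y
    by (simp add: sum_fun_apply)
  have "q x = (\<Sum>j = 1..N. l j x * w (l j))"
    using inj by (simp add: q_eq sum.reindex mult.commute)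
  also have "\<dots> = (\<Sum>j = 1..N. l j x * q (z j))"
    using nodal q_eq by simp
  finally show ?thesis .
qed

section \<open>Bounds almost everywhere\<close>

lemma AE_lebesgue_on_imp_negligible:
  assumes "AE x in lebesgue_on \<Omega>. P x" "\<Omega> \<in> sets lebesgue"
  shows "negligible {x \<in> \<Omega>. \<not> P x}"
proof -
  have "AE x in lebesgue. x \<in> \<Omega> \<longrightarrow> P x"
    using assms by (simp add: AE_restrict_space_iff)
  from AE_E3[OF this]
  obtain N where N: "\<And>x. x \<in> space lebesgue - N \<Longrightarrow> x \<in> \<Omega> \<longrightarrow> P x" "N \<in> null_sets lebesgue"
    by blast
  then have "{x \<in> \<Omega>. \<not> P x} \<subseteq> N"
    by auto
  then show ?thesis
    using N(2) negligible_iff_null_sets negligible_subset by blast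
qed

lemma negligible_linf_norm_exceeds:
  assumes "linf_norm \<Omega> g = ennreal M" "0 \<le> M" "\<Omega> \<in> sets lebesgue"
  shows "negligible {x \<in> \<Omega>. norm (g x) > M}"
proof -
  have "AE x in lebesgue_on \<Omega>. ennreal (norm (g x)) \<le> ennreal M"
    using esssup_AE[of "\<lambda>x. ennreal (norm (g x))" "lebesgue_on \<Omega>"] assms(1)
    by (simp add: linf_norm_def)
  from AE_lebesgue_on_imp_negligible[OF this assms(3)] show ?thesis
    using assms(2) by (simp add: ennreal_le_iff not_le)
qed

text \<open>
  Arbitrarily close to \<open>x\<close> there is a non-null set of points of \<open>K\<close> where \<open>g\<close> is close to \<open>g x\<close>; such
  a set is not contained in \<open>N\<close>, so the bound can be tested at one of its points, where \<open>h\<close> is close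
  to \<open>h x\<close>.  In this way a bound that holds almost everywhere reaches the interpolation nodes.
\<close>
lemma essential_value_norm_le:
  fixes g h :: "'a::euclidean_space \<Rightarrow> 'b::real_normed_vector"
  assumes ess: "essential_value_at K g x"
    and h: "continuous_on UNIV h"
    and N: "negligible N" "\<And>y. y \<in> K - N \<Longrightarrow> norm (g y - h y) \<le> M"
  shows "norm (g x - h x) \<le> M"
proof (rule field_le_epsilon)
  fix e :: real
  assume "e > 0"
  then obtain r where r: "r > 0" "\<And>y. dist y x < r \<Longrightarrow> dist (h y) (h x) < e / 2"
    using h unfolding continuous_on_iff by (metis UNIV_I half_gt_zero)
  let ?s = "min r (e / 2)"
  have "\<not> negligible {y \<in> K \<inter> ball x ?s. dist (g y) (g x) < ?s}"
    using ess[unfolded essential_value_at_def, rule_format, of ?s] r(1) \<open>e > 0\<close> by linarith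
  then have "\<not> {y \<in> K \<inter> ball x ?s. dist (g y) (g x) < ?s} \<subseteq> N"
    using N(1) negligible_subset by blast
  then obtain y where y: "y \<in> K - N" "dist x y < ?s" "dist (g y) (g x) < ?s"
    by auto
  have "g x - h x = (g x - g y) + (g y - h y) + (h y - h x)"
    by simp
  then have "norm (g x - h x) \<le> norm (g x - g y) + norm (g y - h y) + norm (h y - h x)"
    using norm_triangle_ineq[of "g x - g y + (g y - h y)" "h y - h x"]
      norm_triangle_ineq[of "g x - g y" "g y - h y"] by simp
  also have "\<dots> \<le> e / 2 + M + e / 2"
    using N(2)[OF y(1)] r(2)[of y] y(2,3)
    by (intro add_mono) (auto simp: dist_norm norm_minus_commute)
  finally show "norm (g x - h x) \<le> M + e" by simp
qed

text \<open>
  Lebesgue's estimate.  Interpolation is linear and reproduces \<open>Q\<close>, so the error of \<open>g\<close> at \<open>x\<close> is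
  \<open>g x - Q x\<close> minus the interpolant of \<open>g - Q\<close>, whose nodal values are bounded by \<open>M\<close> as well.
\<close>
lemma interpolation_error_le:
  fixes g Q :: "'a::euclidean_space \<Rightarrow> 'b::euclidean_space" and l :: "nat \<Rightarrow> 'a \<Rightarrow> real"
    and k :: nat
  defines "n \<equiv> num_nodes k DIM('a)"
  assumes deg: "\<And>j. j \<in> {1..n} \<Longrightarrow> poly_deg_le k (l j)"
    and dual: "\<And>j m. j \<in> {1..n} \<Longrightarrow> m \<in> {1..n} \<Longrightarrow> l j (z m) = (if j = m then 1 else 0)"
    and Q: "\<And>b. b \<in> Basis \<Longrightarrow> poly_deg_le k (\<lambda>x. Q x \<bullet> b)"
    and ess: "\<And>j. j \<in> {1..n} \<Longrightarrow> essential_value_at K g (z j)"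
    and N: "negligible N" "\<And>y. y \<in> K - N \<Longrightarrow> norm (g y - Q y) \<le> M"
    and x: "x \<in> K - N" "(\<Sum>j = 1..n. \<bar>l j x\<bar>) \<le> \<Lambda>"
  shows "norm (g x - (\<Sum>j = 1..n. l j x *\<^sub>R g (z j))) \<le> (1 + \<Lambda>) * M"
proof -
  have "Q x = (\<Sum>j = 1..n. l j x *\<^sub>R Q (z j))"
  proof (rule euclidean_eqI)
    fix b :: 'b assume "b \<in> Basis"
    then show "Q x \<bullet> b = (\<Sum>j = 1..n. l j x *\<^sub>R Q (z j)) \<bullet> b"
      using lagrange_expansion[of k l z "\<lambda>x. Q x \<bullet> b" x] deg dual Q
      by (simp add: n_def inner_sum_left)
  qed
  then have split: "g x - (\<Sum>j = 1..n. l j x *\<^sub>R g (z j))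
      = (g x - Q x) - (\<Sum>j = 1..n. l j x *\<^sub>R (g (z j) - Q (z j)))"
    by (simp add: scaleR_diff_right sum_subtractf)
  have "continuous_on UNIV (\<lambda>x. \<Sum>b\<in>Basis. (Q x \<bullet> b) *\<^sub>R b)"
    by (intro continuous_on_sum continuous_on_scaleR continuous_on_poly_deg_le[OF Q]
        continuous_on_const)
  then have Q_cont: "continuous_on UNIV Q"
    by (simp add: euclidean_representation)
  have M: "0 \<le> M"
    using N(2)[OF x(1)] norm_ge_zero order_trans by blast
  have "norm (\<Sum>j = 1..n. l j x *\<^sub>R (g (z j) - Q (z j))) \<le> (\<Sum>j = 1..n. \<bar>l j x\<bar> * M)"
    using essential_value_norm_le[OF ess Q_cont N]
    by (intro sum_norm_le) (auto intro: mult_left_mono)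
  also have "\<dots> \<le> \<Lambda> * M"
    using M x(2) by (simp add: sum_distrib_right[symmetric] mult_right_mono)
  finally show ?thesis
    unfolding split using N(2)[OF x(1)]
      norm_triangle_ineq4[of "g x - Q x" "\<Sum>j = 1..n. l j x *\<^sub>R (g (z j) - Q (z j))"]
    by (simp add: algebra_simps)
qed

text \<open>
  A point value of a continuous function is an essential value, so it obeys every bound that holds
  almost everywhere: this is the comparison of essential values with \<open>h = 0\<close>.
\<close>
lemma norm_le_linf_norm:
  assumes cont: "continuous_on \<Omega> g" and \<Omega>: "convex \<Omega>" "\<Omega> \<in> sets lebesgue" "interior \<Omega> \<noteq> {}"
    and x: "x \<in> \<Omega>"
  shows "ennreal (norm (g x)) \<le> linf_norm \<Omega> g"
proof (cases "linf_norm \<Omega> g")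
  case (real M)
  have neg: "negligible {y \<in> \<Omega>. norm (g y) > M}"
    using negligible_linf_norm_exceeds[of \<Omega> g M] real \<Omega>(2) by simp
  have "essential_value_at \<Omega> g x"
    using cont x \<Omega> by (intro essential_value_at_continuous) (auto simp: continuous_on_eq_continuous_within)
  then have "norm (g x - 0) \<le> M"
    by (rule essential_value_norm_le[OF _ _ neg]) auto
  then show ?thesis
    using real by (simp add: ennreal_leI)
qed simp

lemma l2_norm_le:
  assumes g: "g \<in> borel_measurable (lebesgue_on \<Omega>)" and \<Omega>: "\<Omega> \<in> lmeasurable"
    and N: "negligible N" "\<And>x. x \<in> \<Omega> - N \<Longrightarrow> norm (g x) \<le> B" and B: "0 \<le> B"
  shows "l2_norm \<Omega> g \<le> ennreal (sqrt (measure lebesgue \<Omega>) * B)"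
proof -
  have \<Omega>_sets: "\<Omega> \<in> sets lebesgue"
    using \<Omega> by blast
  have fin: "finite_measure (lebesgue_on \<Omega>)"
    using \<Omega> by (rule finite_measure_lebesgue_on)
  have "AE x in lebesgue. x \<notin> N"
    using N(1) by (simp add: negligible_iff_null_sets AE_not_in)
  then have "AE x in lebesgue_on \<Omega>. x \<notin> N"
    using \<Omega>_sets by (auto simp: AE_restrict_space_iff elim: eventually_mono)
  then have bound: "AE x in lebesgue_on \<Omega>. g x \<bullet> g x \<le> B\<^sup>2"
  proof (rule AE_mp, intro AE_I2 impI)
    fix x assume "x \<in> space (lebesgue_on \<Omega>)" "x \<notin> N"
    then have "norm (g x) \<le> B"
      using N(2) by (simp add: space_restrict_space)
    then show "g x \<bullet> g x \<le> B\<^sup>2"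
      by (simp add: dot_square_norm power_mono)
  qed
  have int: "integrable (lebesgue_on \<Omega>) (\<lambda>x. g x \<bullet> g x)"
    using g bound by (intro finite_measure.integrable_const_bound[OF fin, of _ "B\<^sup>2"]) auto
  have "(\<integral>x. g x \<bullet> g x \<partial>lebesgue_on \<Omega>) \<le> (\<integral>x. B\<^sup>2 \<partial>lebesgue_on \<Omega>)"
    using int bound fin by (intro integral_mono_AE) (auto simp: finite_measure.integrable_const)
  also have "\<dots> = measure lebesgue \<Omega> * B\<^sup>2"
    using \<Omega>_sets by (simp add: measure_restrict_space space_restrict_space)
  finally have "sqrt (\<integral>x. g x \<bullet> g x \<partial>lebesgue_on \<Omega>) \<le> sqrt (measure lebesgue \<Omega>) * B"
    using B by (metis real_sqrt_le_mono real_sqrt_mult real_sqrt_abs abs_of_nonneg)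
  then show ?thesis
    using g int by (simp add: l2_norm_def L2_field_def ennreal_leI)
qed

section \<open>Geometry of simplices and the mesh constants\<close>

lemma interior_nonempty_of_full_dimension:
  fixes C :: "'a::euclidean_space set"
  assumes "convex C" "aff_dim C = int DIM('a)"
  shows "interior C \<noteq> {}"
proof -
  have "C \<noteq> {}"
    using assms(2) by (metis aff_dim_empty_eq of_nat_0_le_iff neg_0_le_iff_le not_one_le_zero)
  moreover have "rel_interior C = interior C"
    using assms(2) by (simp add: aff_dim_eq_full rel_interior_interior)
  ultimately show ?thesis
    using rel_interior_eq_empty[OF assms(1)] by simp
qed

lemma simplex_vertices:
  assumes "n simplex K"
  shows "\<not> affine_dependent (vertices K)" "K = convex hull vertices K" "finite (vertices K)"
proof -
  obtain C where C: "finite C" "\<not> affine_dependent C" "K = convex hull C"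
    using assms unfolding simplex by blast
  then have "vertices K = C"
    by (auto simp: vertices_def extreme_point_of_convex_hull_affine_independent)
  with C show "\<not> affine_dependent (vertices K)" "K = convex hull vertices K" "finite (vertices K)"
    by simp_all
qed

lemma negligible_Diff_interior_simplex:
  assumes "n simplex K"
  shows "negligible (K - interior K)"
proof -
  have "K - interior K \<subseteq> frontier K"
    using closure_subset[of K] by (auto simp: frontier_def)
  then show ?thesis
    using negligible_convex_frontier[OF convex_simplex[OF assms]] negligible_subset by blast
qed

lemma height_le_dist_vertex:
  fixes p :: "'a::euclidean_space set \<Rightarrow> nat \<Rightarrow> 'a"
  assumes "r \<in> {1..DIM('a) + 1}" "r \<noteq> s"
  shows "infdist (p K s) (affine hull (opposite_facet p K s)) \<le> dist (p K s) (p K r)"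
proof (rule infdist_le)
  have "p K r \<in> opposite_facet p K s"
    using assms unfolding opposite_facet_def by (auto intro!: hull_inc)
  then show "p K r \<in> affine hull (opposite_facet p K s)"
    by (rule hull_inc)
qed

lemma height_pos:
  fixes p :: "'a::euclidean_space set \<Rightarrow> nat \<Rightarrow> 'a"
  assumes indep: "\<not> affine_dependent (vertices K)"
    and bij: "bij_betw (p K) {1..DIM('a) + 1} (vertices K)"
    and s: "s \<in> {1..DIM('a) + 1}"
  shows "0 < infdist (p K s) (affine hull (opposite_facet p K s))"
proof (rule infdist_pos_not_in_closed)
  have "p K ` ({1..DIM('a) + 1} - {s}) = vertices K - {p K s}"
    using bij s unfolding bij_betw_def by (auto simp: inj_on_def)
  then have "affine hull (opposite_facet p K s) = affine hull (vertices K - {p K s})"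
    by (simp add: opposite_facet_def)
  moreover have "p K s \<in> vertices K"
    using bij s bij_betwE by blast
  ultimately show "p K s \<notin> affine hull (opposite_facet p K s)"
    using indep unfolding affine_dependent_def by metis
  (* In dimension at least one, a facet has a vertex. *)
  have "{1..DIM('a) + 1} - {s} \<noteq> {}"
  proof -
    have "card ({1..DIM('a) + 1} - {s}) = DIM('a)"
      using s by simp
    then show ?thesis
      using DIM_positive[where 'a = 'a] by (metis card.empty less_irrefl)
  qed
  then show "affine hull (opposite_facet p K s) \<noteq> {}"
    by (simp add: opposite_facet_def)
qed simp

text \<open>\<^const>\<open>C1_const\<close> is a dimensional factor times the least ratio of this height to the diameter.\<close>
definition min_height :: "('a::euclidean_space set \<Rightarrow> nat \<Rightarrow> 'a) \<Rightarrow> 'a set \<Rightarrow> real" where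
  "min_height p K =
     Min ((\<lambda>s. infdist (p K s) (affine hull (opposite_facet p K s))) ` {1..DIM('a) + 1})"

lemma min_height_pos:
  fixes p :: "'a::euclidean_space set \<Rightarrow> nat \<Rightarrow> 'a"
  assumes "\<not> affine_dependent (vertices K)" "bij_betw (p K) {1..DIM('a) + 1} (vertices K)"
  shows "0 < min_height p K"
  unfolding min_height_def using height_pos[of K p] assms by (subst Min_gr_iff) auto

lemma min_height_le_edge:
  fixes p :: "'a::euclidean_space set \<Rightarrow> nat \<Rightarrow> 'a"
  assumes "r \<in> {1..DIM('a) + 1}" "s \<in> {1..DIM('a) + 1}" "r \<noteq> s"
  shows "min_height p K \<le> dist (p K s) (p K r)"
proof -
  have "min_height p K \<le> infdist (p K s) (affine hull (opposite_facet p K s))"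
    unfolding min_height_def using assms(2) by (intro Min_le) auto
  also have "\<dots> \<le> dist (p K s) (p K r)"
    by (rule height_le_dist_vertex[OF assms(1,3)])
  finally show ?thesis .
qed

text \<open>A single edge is already at least as long as the height of either of its end points.\<close>
lemma min_height_sq_le_edge_sum:
  fixes p :: "'a::euclidean_space set \<Rightarrow> nat \<Rightarrow> 'a"
  assumes "0 \<le> min_height p K"
  shows "(min_height p K)\<^sup>2
    \<le> (\<Sum>i = 1..DIM('a) + 1. \<Sum>j\<in>{1..<i}. edge_vec p K i j \<bullet> edge_vec p K i j)"
proof -
  have two: "2 \<in> {1..DIM('a) + 1}" "1 \<in> {1..DIM('a) + 1}"
    using DIM_positive[where 'a = 'a] by auto
  have "(min_height p K)\<^sup>2 \<le> (dist (p K 2) (p K 1))\<^sup>2"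
    using assms min_height_le_edge[OF two(2,1)] by (intro power_mono) auto
  also have "\<dots> = edge_vec p K 2 1 \<bullet> edge_vec p K 2 1"
    by (simp add: edge_vec_def dist_norm norm_minus_commute dot_square_norm)
  also have "\<dots> = (\<Sum>j\<in>{1..<2}. edge_vec p K 2 j \<bullet> edge_vec p K 2 j)"
    by (simp add: numeral_2_eq_2)
  also have "\<dots> \<le> (\<Sum>i = 1..DIM('a) + 1. \<Sum>j\<in>{1..<i}. edge_vec p K i j \<bullet> edge_vec p K i j)"
    using two(1)
    by (intro member_le_sum[of 2 _ "\<lambda>i. \<Sum>j\<in>{1..<i}. edge_vec p K i j \<bullet> edge_vec p K i j"])
       (auto intro!: sum_nonneg)
  finally show ?thesis .
qed

lemma C1_const_pos:
  fixes p :: "'a::euclidean_space set \<Rightarrow> nat \<Rightarrow> 'a"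
  assumes "finite \<T>" "\<T> \<noteq> {}" "\<And>K. K \<in> \<T> \<Longrightarrow> 0 < min_height p K / diameter K"
  shows "0 < C1_const \<T> p"
proof -
  have "0 < Min ((\<lambda>K. min_height p K / diameter K) ` \<T>)"
    using assms by (subst Min_gr_iff) auto
  moreover have "0 < sqrt ((real DIM('a) + 1) / (2 * real DIM('a)))"
    using DIM_positive[where 'a = 'a] by simp
  ultimately show ?thesis
    unfolding C1_const_def min_height_def by (rule mult_pos_pos[rotated])
qed

text \<open>The dimensional factor \<open>(d + 1) / (2 d)\<close> is at most one, because \<open>d \<ge> 1\<close>.\<close>
lemma C1_const_le:
  fixes p :: "'a::euclidean_space set \<Rightarrow> nat \<Rightarrow> 'a"
  assumes "finite \<T>" "K \<in> \<T>" "\<And>K. K \<in> \<T> \<Longrightarrow> 0 < min_height p K / diameter K"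
  shows "C1_const \<T> p \<le> min_height p K / diameter K"
proof -
  let ?m = "Min ((\<lambda>K. min_height p K / diameter K) ` \<T>)"
  have "1 \<le> real DIM('a)"
    using DIM_positive[where 'a = 'a] by linarith
  then have "(real DIM('a) + 1) / (2 * real DIM('a)) \<le> 1"
    by (simp add: divide_le_eq)
  then have "sqrt ((real DIM('a) + 1) / (2 * real DIM('a))) \<le> 1"
    by simp
  moreover have "0 \<le> ?m"
    using assms by (intro Min.boundedI) (auto intro: less_imp_le)
  ultimately have "C1_const \<T> p \<le> ?m"
    unfolding C1_const_def min_height_def by (rule mult_left_le_one_le[OF _ real_sqrt_ge_zero, rotated 2]) simp
  also have "?m \<le> min_height p K / diameter K"
    using assms by (intro Min_le) auto
  finally show ?thesis .
qed

text \<open>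
  Both terms of the minimum that defines \<^const>\<open>C3_const\<close> dominate \<open>1 / (diameter K)\<^sup>2\<close>: the second
  because \<open>\<eta>\<close> is at most the diameter, the first because \<open>1 / (diameter K)\<^sup>2\<close> is at most
  \<open>v + \<bar>\<zeta> K\<bar>\<close>, where \<open>v\<close> is bounded by the \<open>L\<^sub>\<infinity>\<close> norm, and the curvature term is nonnegative.
\<close>
lemma inverse_diameter_le_C3_const:
  assumes fin: "finite \<T>" and K: "K \<in> \<T>" and \<eta>: "0 < \<eta>" "\<eta> \<le> diameter K"
    and v: "1 / (diameter K)\<^sup>2 + \<zeta> K \<le> v" "0 \<le> v" "ennreal v \<le> linf_norm \<Omega> (\<lambda>x. 1 / (D x)\<^sup>2)"
  shows "1 / diameter K \<le> C3_const \<Omega> \<T> \<eta> D \<zeta>"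
proof -
  let ?Z = "Max ((\<lambda>K. \<bar>\<zeta> K\<bar>) ` \<T>)"
  let ?A = "ennreal (1 / 2 * Max ((\<lambda>K. (min_containment_radius K)\<^sup>2) ` \<T>))
            * C2_seminorm \<Omega> (\<lambda>x. 1 / (D x)\<^sup>2)"
  let ?m = "min (?A + linf_norm \<Omega> (\<lambda>x. 1 / (D x)\<^sup>2) + ennreal ?Z) (ennreal (1 / \<eta>\<^sup>2))"
  have Z: "\<bar>\<zeta> K\<bar> \<le> ?Z"
    using fin K by (intro Max_ge) auto
  then have "1 / (diameter K)\<^sup>2 \<le> v + ?Z"
    using v(1) by linarith
  then have "ennreal (1 / (diameter K)\<^sup>2) \<le> ennreal v + ennreal ?Z"
    using v(2) Z by (metis abs_ge_zero ennreal_leI ennreal_plus order_trans)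
  also have "\<dots> \<le> ?A + linf_norm \<Omega> (\<lambda>x. 1 / (D x)\<^sup>2) + ennreal ?Z"
    using v(3) by (intro add_right_mono order_trans[OF v(3)]) simp
  finally have "ennreal (1 / (diameter K)\<^sup>2) \<le> ?m"
    using \<eta> by (auto intro!: ennreal_leI divide_left_mono power_mono mult_pos_pos)
  moreover have "?m < top"
    by (simp add: min_less_iff_disj)
  ultimately have "1 / (diameter K)\<^sup>2 \<le> enn2real ?m"
    using enn2real_mono[of "ennreal (1 / (diameter K)\<^sup>2)" ?m] by simp
  then have "sqrt (1 / (diameter K)\<^sup>2) \<le> C3_const \<Omega> \<T> \<eta> D \<zeta>"
    unfolding C3_const_def by (rule real_sqrt_le_mono)
  then show ?thesis
    using \<eta> by (simp add: real_sqrt_divide)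
qed

text \<open>
  On every element, \<open>c\<^sup>2\<close> is at most \<open>C\<^sup>2\<close> times the sum of the squared edge lengths.  Weighting these
  estimates by the volumes of the elements and adding them up produces \<^const>\<open>Theta\<close>.
\<close>
lemma volume_le_Theta:
  fixes p :: "'a::euclidean_space set \<Rightarrow> nat \<Rightarrow> 'a"
  assumes "finite \<T>" and nonneg: "0 \<le> c"
    and bound: "\<And>K. K \<in> \<T> \<Longrightarrow> c \<le> C * min_height p K" "\<And>K. K \<in> \<T> \<Longrightarrow> 0 \<le> min_height p K"
    and meas: "\<And>K. K \<in> \<T> \<Longrightarrow> K \<in> sets lebesgue"
  shows "c\<^sup>2 * measure lebesgue (\<Union>\<T>) \<le> C\<^sup>2 * Theta \<T> p"
proof -
  let ?E = "\<lambda>K. \<Sum>i = 1..DIM('a) + 1. \<Sum>j\<in>{1..<i}. edge_vec p K i j \<bullet> edge_vec p K i j"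
  have "c\<^sup>2 * measure lebesgue (\<Union>\<T>) \<le> c\<^sup>2 * (\<Sum>K\<in>\<T>. measure lebesgue K)"
    using assms(1) meas by (intro mult_left_mono measure_Union_le) auto
  also have "\<dots> = (\<Sum>K\<in>\<T>. c\<^sup>2 * measure lebesgue K)"
    by (rule sum_distrib_left)
  also have "\<dots> \<le> (\<Sum>K\<in>\<T>. (C\<^sup>2 * ?E K) * measure lebesgue K)"
  proof (intro sum_mono mult_right_mono)
    fix K assume K: "K \<in> \<T>"
    have "c\<^sup>2 \<le> (C * min_height p K)\<^sup>2"
      using nonneg bound(1)[OF K] by (rule power_mono[rotated])
    also have "\<dots> = C\<^sup>2 * (min_height p K)\<^sup>2"
      by (rule power_mult_distrib)
    also have "\<dots> \<le> C\<^sup>2 * ?E K"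
      by (intro mult_left_mono min_height_sq_le_edge_sum bound(2) K) simp
    finally show "c\<^sup>2 \<le> C\<^sup>2 * ?E K" .
  qed simp
  also have "\<dots> = C\<^sup>2 * Theta \<T> p"
    unfolding Theta_def by (subst sum_distrib_left) (simp only: mult.assoc)
  finally show ?thesis .
qed

section \<open>Interpolation on a mesh\<close>

lemma borel_measurable_of_null_set:
  assumes "negligible N"
  shows "f \<in> borel_measurable (lebesgue_on N)"
proof (rule measurableI)
  fix A
  have "f -` A \<inter> N \<in> sets lebesgue"
    using assms by (meson Int_lower2 negligible_imp_sets negligible_subset)
  then show "f -` A \<inter> space (lebesgue_on N) \<in> sets (lebesgue_on N)"
    using assms by (auto simp: sets_restrict_space_iff negligible_imp_sets space_restrict_space)
qed simp

text \<open>
  The interiors of the elements and the exceptional null set cover \<open>\<Omega>\<close>; on the null set every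
  function is Lebesgue measurable, by completeness.
\<close>
lemma borel_measurable_piecewise_continuous:
  fixes g :: "'a::euclidean_space \<Rightarrow> 'b::euclidean_space"
  assumes "\<Omega> \<in> sets lebesgue" "finite \<T>"
    and null: "negligible (\<Omega> - (\<Union>K\<in>\<T>. interior K))"
    and cont: "\<And>K. K \<in> \<T> \<Longrightarrow> continuous_on (interior K) g"
  shows "g \<in> borel_measurable (lebesgue_on \<Omega>)"
proof (rule measurable_piecewise_restrict)
  let ?N = "\<Omega> - (\<Union>K\<in>\<T>. interior K)"
  let ?C = "insert ?N (interior ` \<T>)"
  show "countable ?C"
    using assms(2) by (simp add: countable_finite)
  show "space (lebesgue_on \<Omega>) \<subseteq> \<Union>?C"
    by auto
  fix U assume U: "U \<in> ?C"
  then have U_sets: "U \<in> sets lebesgue"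
    using null negligible_imp_sets by auto
  then show "U \<inter> space (lebesgue_on \<Omega>) \<in> sets (lebesgue_on \<Omega>)"
    using assms(1) by (simp add: sets_restrict_space_iff)
  have "g \<in> borel_measurable (lebesgue_on U)"
    using U null cont U_sets
    by (auto intro: borel_measurable_of_null_set continuous_imp_measurable_on_sets_lebesgue)
  then have "g \<in> borel_measurable (restrict_space (lebesgue_on U) \<Omega>)"
    by (rule measurable_restrict_space1)
  then show "g \<in> borel_measurable (restrict_space (lebesgue_on \<Omega>) U)"
    by (simp add: restrict_restrict_space U_sets assms(1) Int_commute)
qed

lemma lebesgue_constant_upper:
  fixes L :: "nat \<Rightarrow> 'a::euclidean_space \<Rightarrow> real"
  assumes "lagrange_basis k Kref \<xi> L" "y \<in> Kref"
  shows "(\<Sum>m = 1..num_nodes k DIM('a). \<bar>L m y\<bar>) \<le> lebesgue_constant k Kref L"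
proof -
  have "compact Kref"
    using assms(1) compact_simplex unfolding lagrange_basis_def by blast
  moreover have "continuous_on Kref (\<lambda>y. \<Sum>m = 1..num_nodes k DIM('a). \<bar>L m y\<bar>)"
    using assms(1) unfolding lagrange_basis_def
    by (intro continuous_on_sum continuous_on_rabs continuous_on_poly_deg_le[of k]) auto
  ultimately have "bdd_above ((\<lambda>y. \<Sum>m = 1..num_nodes k DIM('a). \<bar>L m y\<bar>) ` Kref)"
    by (intro bounded_imp_bdd_above compact_imp_bounded compact_continuous_image)
  then show ?thesis
    unfolding lebesgue_constant_def using assms(2) by (rule cSUP_upper[rotated])
qed

text \<open>
  The transported functions \<open>L j \<circ> X K\<close> form a Lagrange basis for the nodes in \<open>K\<close>, and \<open>fs\<close> agrees in
  the interior of \<open>K\<close> with a polynomial field \<open>Q\<close>.  The nodes may lie on the boundary of \<open>K\<close>, where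
  \<open>fs\<close> is arbitrary, so \<open>f\<close> is compared with \<open>Q\<close> there.
\<close>
lemma mesh_cell_interpolation_error:
  fixes f fs fh :: "'a::euclidean_space \<Rightarrow> 'a" and L :: "nat \<Rightarrow> 'a \<Rightarrow> real" and k :: nat
  assumes K: "K \<in> \<T>"
    and basis: "lagrange_basis k Kref \<xi> L"
    and maps: "reference_maps \<T> Kref X"
    and ess: "\<forall>K \<in> \<T>. \<forall>j \<in> {1..num_nodes k DIM('a)}. essential_value_at K f (node X \<xi> K j)"
    and interp: "piecewise_interpolant k \<T> X \<xi> L f fh"
    and pw: "\<And>b. b \<in> Basis \<Longrightarrow> \<exists>q. poly_deg_le k q \<and> (\<forall>x \<in> interior K. fs x \<bullet> b = q x)"
    and N: "negligible N" "K - N \<subseteq> interior K" "\<And>y. y \<in> K - N \<Longrightarrow> norm (f y - fs y) \<le> M"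
    and x: "x \<in> K - N"
  shows "norm (f x - fh x) \<le> (1 + lebesgue_constant k Kref L) * M"
proof -
  let ?n = "num_nodes k DIM('a)"
  obtain A t where A: "linear A" "\<And>x. X K x = A x + t"
    using maps K unfolding reference_maps_def by blast
  have X: "bij (X K)" "X K ` K = Kref"
    using maps K unfolding reference_maps_def by blast+
  obtain q where q: "\<And>b. b \<in> Basis \<Longrightarrow> poly_deg_le k (q b)"
    "\<And>b x. b \<in> Basis \<Longrightarrow> x \<in> interior K \<Longrightarrow> fs x \<bullet> b = q b x"
    using pw by metis
  define Q where "Q x = (\<Sum>b\<in>Basis. q b x *\<^sub>R b)" for x
  have Q_comp: "Q x \<bullet> b = q b x" if "b \<in> Basis" for x b
    using that by (simp add: Q_def inner_sum_left_Basis)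
  have fs_Q: "fs x = Q x" if "x \<in> interior K" for x
    using that by (auto intro: euclidean_eqI[of "fs x" "Q x"] simp: Q_comp q(2))
  have "fh x = (\<Sum>j = 1..?n. L j (X K x) *\<^sub>R f (node X \<xi> K j))"
    using interp K N(2) x unfolding piecewise_interpolant_def by blast
  moreover have "norm (f x - (\<Sum>j = 1..?n. L j (X K x) *\<^sub>R f (node X \<xi> K j)))
      \<le> (1 + lebesgue_constant k Kref L) * M"
  proof (rule interpolation_error_le[where k = k and l = "\<lambda>j x. L j (X K x)" and Q = Q])
    show "poly_deg_le k (\<lambda>x. L j (X K x))" if "j \<in> {1..?n}" for j
      unfolding A(2) using that basis A(1) unfolding lagrange_basis_def
      by (intro poly_deg_le_compose_affine) auto
    show "L j (X K (node X \<xi> K m)) = (if j = m then 1 else 0)"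
      if "j \<in> {1..?n}" "m \<in> {1..?n}" for j m
    proof -
      have "X K (node X \<xi> K m) = \<xi> m"
        unfolding node_def using X(1) by (simp add: bij_is_surj surj_f_inv_f)
      then show ?thesis
        using basis that unfolding lagrange_basis_def by auto
    qed
    show "poly_deg_le k (\<lambda>x. Q x \<bullet> b)" if "b \<in> Basis" for b
      using q(1)[OF that] by (simp add: Q_comp[OF that])
    show "essential_value_at K f (node X \<xi> K j)" if "j \<in> {1..?n}" for j
      using ess K that by blast
    show "norm (f y - Q y) \<le> M" if "y \<in> K - N" for y
      using N(2) N(3)[OF that] fs_Q that by (metis subsetD)
    show "(\<Sum>j = 1..?n. \<bar>L j (X K x)\<bar>) \<le> lebesgue_constant k Kref L"
      using X(2) x by (intro lebesgue_constant_upper[OF basis]) auto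
  qed (use N(1) x in auto)
  ultimately show ?thesis by simp
qed

lemma continuous_on_interpolant:
  fixes f fh :: "'a::euclidean_space \<Rightarrow> 'a" and L :: "nat \<Rightarrow> 'a \<Rightarrow> real"
  assumes K: "K \<in> \<T>"
    and basis: "lagrange_basis k Kref \<xi> L"
    and maps: "reference_maps \<T> Kref X"
    and interp: "piecewise_interpolant k \<T> X \<xi> L f fh"
  shows "continuous_on (interior K) fh"
proof -
  obtain A t where A: "linear A" "\<And>x. X K x = A x + t"
    using maps K unfolding reference_maps_def by blast
  have "continuous_on (interior K)
      (\<lambda>x. \<Sum>j = 1..num_nodes k DIM('a). L j (X K x) *\<^sub>R f (node X \<xi> K j))"
  proof (intro continuous_on_sum continuous_on_scaleR continuous_on_const)
    fix j assume "j \<in> {1..num_nodes k DIM('a)}"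
    then have "poly_deg_le k (L j)"
      using basis unfolding lagrange_basis_def by blast
    then show "continuous_on (interior K) (\<lambda>x. L j (X K x))"
      unfolding A(2) by (intro continuous_on_poly_deg_le poly_deg_le_compose_affine A(1))
  qed
  then show ?thesis
    using interp K unfolding piecewise_interpolant_def by (simp cong: continuous_on_cong)
qed

lemma C2_on_imp_continuous_on:
  fixes g :: "'a::euclidean_space \<Rightarrow> real"
  assumes "C2_on \<Omega> g"
  shows "continuous_on \<Omega> g"
proof -
  obtain g' :: "'a \<Rightarrow> 'a \<Rightarrow>\<^sub>L real"
    where "\<forall>x \<in> \<Omega>. (g has_derivative blinfun_apply (g' x)) (at x within \<Omega>)"
    using assms unfolding C2_on_def by blast
  then show ?thesis
    by (intro has_derivative_continuous_on[of \<Omega> g "\<lambda>x. blinfun_apply (g' x)"]) blast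
qed

lemma mesh_element_subset_hull:
  fixes S :: "'a::euclidean_space set"
  assumes "simplicial_mesh \<T> S" "K \<in> \<T>"
  shows "K \<subseteq> convex hull S"
proof -
  have "int DIM('a) simplex K" "vertices K \<subseteq> S"
    using assms unfolding simplicial_mesh_def by auto
  then show ?thesis
    using simplex_vertices(2) hull_mono by metis
qed

text \<open>
  The mesh lies inside the convex hull and has the same volume, so it misses only a null set of it;
  the boundaries of the elements are null sets because the elements are convex.
\<close>
lemma mesh_covers_almost_everywhere:
  fixes S :: "'a::euclidean_space set"
  assumes mesh: "simplicial_mesh \<T> S" and S: "finite S"
  shows "negligible (convex hull S - (\<Union>K\<in>\<T>. interior K))"
proof -
  have fin: "finite \<T>" and simplices: "\<And>K. K \<in> \<T> \<Longrightarrow> int DIM('a) simplex K"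
    and vol: "measure lebesgue (\<Union>\<T>) = measure lebesgue (convex hull S)"
    using mesh unfolding simplicial_mesh_def triangulation_def by auto
  have sub: "\<Union>\<T> \<subseteq> convex hull S"
    using mesh_element_subset_hull[OF mesh] by blast
  have T_meas: "\<Union>\<T> \<in> lmeasurable"
    using fin simplices compact_simplex by (intro lmeasurable_compact compact_Union) auto
  have hull_meas: "convex hull S \<in> lmeasurable"
    using S by (intro lmeasurable_compact finite_imp_compact_convex_hull)
  have "measure lebesgue (convex hull S - \<Union>\<T>) = 0"
    using measurable_measure_Diff[OF hull_meas _ sub] T_meas vol by (simp add: fmeasurableD)
  then have "negligible (convex hull S - \<Union>\<T>)"
    using hull_meas T_meas by (subst negligible_iff_measure0) (auto intro: fmeasurable.Diff)
  moreover have "negligible (\<Union>K\<in>\<T>. K - interior K)"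
    using fin simplices negligible_Diff_interior_simplex by (intro negligible_Union) auto
  ultimately have "negligible ((convex hull S - \<Union>\<T>) \<union> (\<Union>K\<in>\<T>. K - interior K))"
    by (rule negligible_Un)
  then show ?thesis
    by (rule negligible_subset) blast
qed

text \<open>
  The points where the bound \<open>M\<close> fails, those outside the mesh and the boundaries of the elements form
  one null set, off which the estimate on the elements applies.  An almost everywhere bound gives
  the \<open>L\<^sub>2\<close> bound, and also the square integrability that the extended-valued norm asks for.
\<close>
lemma linf_interpolation_bound_to_l2:
  fixes S \<Omega> :: "'a::euclidean_space set" and f fs fh :: "'a \<Rightarrow> 'a"
  assumes \<Omega>: "\<Omega> = convex hull S" and S: "finite S"
    and mesh: "simplicial_mesh \<T> S"
    and basis: "lagrange_basis k Kref \<xi> L"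
    and maps: "reference_maps \<T> Kref X"
    and f: "f \<in> borel_measurable (lebesgue_on \<Omega>)"
    and ess: "\<forall>K \<in> \<T>. \<forall>j \<in> {1..num_nodes k DIM('a)}. essential_value_at K f (node X \<xi> K j)"
    and interp: "piecewise_interpolant k \<T> X \<xi> L f fh"
    and pw: "\<And>K b. K \<in> \<T> \<Longrightarrow> b \<in> Basis \<Longrightarrow>
        \<exists>q. poly_deg_le k q \<and> (\<forall>x \<in> interior K. fs x \<bullet> b = q x)"
    and M: "linf_norm \<Omega> (\<lambda>x. f x - fs x) = ennreal M" "0 \<le> M"
    and \<Lambda>: "0 \<le> lebesgue_constant k Kref L"
  shows "l2_norm \<Omega> (\<lambda>x. f x - fh x)
    \<le> ennreal (sqrt (measure lebesgue \<Omega>) * ((1 + lebesgue_constant k Kref L) * M))"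
proof -
  have fin: "finite \<T>" and simplices: "\<And>K. K \<in> \<T> \<Longrightarrow> int DIM('a) simplex K"
    using mesh unfolding simplicial_mesh_def triangulation_def by auto
  have sub: "K \<subseteq> \<Omega>" if "K \<in> \<T>" for K
    unfolding \<Omega> by (rule mesh_element_subset_hull[OF mesh that])
  have \<Omega>_meas: "\<Omega> \<in> lmeasurable"
    unfolding \<Omega> using S by (intro lmeasurable_compact finite_imp_compact_convex_hull)
  then have \<Omega>_sets: "\<Omega> \<in> sets lebesgue"
    by (rule fmeasurableD)
  have cover: "negligible (\<Omega> - (\<Union>K\<in>\<T>. interior K))"
    unfolding \<Omega> by (rule mesh_covers_almost_everywhere[OF mesh S])
  define N where "N = {x \<in> \<Omega>. norm (f x - fs x) > M} \<union> (\<Omega> - (\<Union>K\<in>\<T>. interior K))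
      \<union> (\<Union>K\<in>\<T>. K - interior K)"
  have "negligible (\<Union>K\<in>\<T>. K - interior K)"
    using fin simplices negligible_Diff_interior_simplex by (intro negligible_Union) auto
  then have N: "negligible N"
    unfolding N_def using negligible_linf_norm_exceeds[OF M \<Omega>_sets] cover by (intro negligible_Un)
  show ?thesis
  proof (rule l2_norm_le[OF _ \<Omega>_meas N])
    have "fh \<in> borel_measurable (lebesgue_on \<Omega>)"
      using \<Omega>_sets fin cover continuous_on_interpolant[OF _ basis maps interp]
      by (rule borel_measurable_piecewise_continuous)
    with f show "(\<lambda>x. f x - fh x) \<in> borel_measurable (lebesgue_on \<Omega>)"
      by (rule borel_measurable_diff)
    fix x assume x: "x \<in> \<Omega> - N"
    then obtain K where K: "K \<in> \<T>" "x \<in> interior K"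
      unfolding N_def by blast
    show "norm (f x - fh x) \<le> (1 + lebesgue_constant k Kref L) * M"
    proof (rule mesh_cell_interpolation_error[OF K(1) basis maps ess interp pw[OF K(1)] N])
      show "K - N \<subseteq> interior K"
        using K(1) unfolding N_def by blast
      show "norm (f y - fs y) \<le> M" if "y \<in> K - N" for y
        using that sub[OF K(1)] unfolding N_def by auto
      show "x \<in> K - N"
        using x K(2) interior_subset by blast
    qed
  qed (use M(2) \<Lambda> in simp)
qed

section \<open>The error estimate\<close>

theorem corollary17:
  fixes S :: "'a::euclidean_space set"
    and \<Omega> :: "'a set"
    and \<T> :: "'a set set"
    and p :: "'a set \<Rightarrow> nat \<Rightarrow> 'a"
    and \<epsilon> \<eta> :: real
    and D :: "'a \<Rightarrow> real"
    and \<zeta> :: "'a set \<Rightarrow> real"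
    and k :: nat
    and Kref :: "'a set"
    and \<xi> :: "nat \<Rightarrow> 'a"
    and L :: "nat \<Rightarrow> 'a \<Rightarrow> real"
    and X :: "'a set \<Rightarrow> 'a \<Rightarrow> 'a"
    and f fh fs :: "'a \<Rightarrow> 'a"
  assumes "\<Omega> = convex hull S"
    and "eps_net S \<epsilon> \<eta>"
    and "simplicial_mesh \<T> S"
    and "vertex_numbering \<T> p"
    and "sizing_function \<Omega> D"
    and "sizing_discrepancy \<T> p D \<zeta>"
    and "lagrange_basis k Kref \<xi> L"
    and "reference_maps \<T> Kref X"
    and "L2_field \<Omega> f"
    and "\<forall>K \<in> \<T>. \<forall>j \<in> {1..num_nodes k DIM('a)}. essential_value_at K f (node X \<xi> K j)"
    and "piecewise_interpolant k \<T> X \<xi> L f fh"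
    and "piecewise_best_approximation k \<T> f fs"
  shows "l2_norm \<Omega> (\<lambda>x. f x - fh x)
           \<le> ennreal ((1 + lebesgue_constant k Kref L) * C3_const \<Omega> \<T> \<eta> D \<zeta> * sqrt (Theta \<T> p)
                       / C1_const \<T> p)
             * linf_norm \<Omega> (\<lambda>x. f x - fs x)"
proof -
  let ?\<Lambda> = "lebesgue_constant k Kref L"
  let ?C1 = "C1_const \<T> p" and ?C3 = "C3_const \<Omega> \<T> \<eta> D \<zeta>"
  have S: "finite S" and \<eta>: "0 < \<eta>" and sep: "\<And>v w. v \<in> S \<Longrightarrow> w \<in> S \<Longrightarrow> v \<noteq> w \<Longrightarrow> \<eta> \<le> dist v w"
    using assms(2) unfolding eps_net_def by blast+
  have fin: "finite \<T>" and simplices: "\<And>K. K \<in> \<T> \<Longrightarrow> int DIM('a) simplex K"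
    and vert: "(\<Union>K\<in>\<T>. vertices K) = S" and dim: "aff_dim S = int DIM('a)"
    and vol: "measure lebesgue (\<Union>\<T>) = measure lebesgue \<Omega>"
    using assms(1,3) unfolding simplicial_mesh_def triangulation_def by auto
  have numbering: "bij_betw (p K) {1..DIM('a) + 1} (vertices K)" if "K \<in> \<T>" for K
    using assms(4) that unfolding vertex_numbering_def by blast
  have interior: "interior \<Omega> \<noteq> {}"
    unfolding assms(1) using dim
    by (intro interior_nonempty_of_full_dimension) (simp_all add: aff_dim_convex_hull)
  have \<Omega>_meas: "\<Omega> \<in> lmeasurable"
    unfolding assms(1) using S by (intro lmeasurable_compact finite_imp_compact_convex_hull)
  have "S \<noteq> {}"
    using interior unfolding assms(1) by auto
  then have nonempty: "\<T> \<noteq> {}"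
    using vert by blast
  have node_in: "p K s \<in> vertices K" if "K \<in> \<T>" "s \<in> {1..DIM('a) + 1}" for K s
    using numbering[OF that(1)] that(2) bij_betwE by blast
  have height: "0 < min_height p K" if "K \<in> \<T>" for K
    using min_height_pos[of K p, OF simplex_vertices(1)[OF simplices[OF that]] numbering[OF that]] .
  have diam: "\<eta> \<le> diameter K" if K: "K \<in> \<T>" for K
  proof -
    have idx: "1 \<in> {1..DIM('a) + 1}" "2 \<in> {1..DIM('a) + 1}"
      using DIM_positive[where 'a = 'a] by auto
    have "p K 1 \<noteq> p K 2"
      using numbering[OF K] idx unfolding bij_betw_def inj_on_def by force
    then have "\<eta> \<le> dist (p K 1) (p K 2)"
      using sep vert node_in[OF K] idx K by blast
    also have "\<dots> \<le> diameter K"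
    proof (rule diameter_bounded_bound)
      show "bounded K"
        using simplices[OF K] compact_simplex compact_imp_bounded by blast
      have "vertices K \<subseteq> K"
        by (auto simp: vertices_def extreme_point_of_def)
      then show "p K 1 \<in> K" "p K 2 \<in> K"
        using node_in[OF K] idx by blast+
    qed
    finally show ?thesis .
  qed
  have ratio: "0 < min_height p K / diameter K" if "K \<in> \<T>" for K
    using height[OF that] diam[OF that] \<eta> by simp
  have C1_pos: "0 < ?C1"
    using fin nonempty ratio by (rule C1_const_pos)
  have sizing_cont: "continuous_on \<Omega> (\<lambda>x. 1 / (D x)\<^sup>2)"
    using assms(5) unfolding sizing_function_def by (blast intro: C2_on_imp_continuous_on)
  have C3_ge: "1 / diameter K \<le> ?C3" if K: "K \<in> \<T>" for K
  proof -
    let ?V = "(\<lambda>i. 1 / (D (p K i))\<^sup>2) ` {1..DIM('a) + 1}"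
    have "Max ?V \<in> ?V"
      by (rule Max_in) auto
    then obtain i where i: "i \<in> {1..DIM('a) + 1}" "Max ?V = 1 / (D (p K i))\<^sup>2"
      by blast
    have "p K i \<in> \<Omega>"
      unfolding assms(1) using node_in[OF K i(1)] vert K by (auto intro: hull_inc)
    then have "ennreal (norm (1 / (D (p K i))\<^sup>2)) \<le> linf_norm \<Omega> (\<lambda>x. 1 / (D x)\<^sup>2)"
      using assms(1) \<Omega>_meas by (intro norm_le_linf_norm sizing_cont interior) (auto simp: fmeasurableD)
    moreover have "1 / (diameter K)\<^sup>2 + \<zeta> K \<le> 1 / (D (p K i))\<^sup>2"
      using assms(6) K i(2) unfolding sizing_discrepancy_def by fastforce
    ultimately show ?thesis
      by (intro inverse_diameter_le_C3_const[OF fin K \<eta> diam[OF K], of \<zeta> "1 / (D (p K i))\<^sup>2"]) auto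
  qed
  obtain K0 where "K0 \<in> \<T>"
    using nonempty by blast
  moreover have "0 < 1 / diameter K0"
    using diam[OF \<open>K0 \<in> \<T>\<close>] \<eta> by simp
  ultimately have C3_pos: "0 < ?C3"
    using C3_ge by (meson less_le_trans)
  have "?C1 \<le> ?C3 * min_height p K" if K: "K \<in> \<T>" for K
  proof -
    have "?C1 \<le> (1 / diameter K) * min_height p K"
      using C1_const_le[OF fin K ratio] by simp
    also have "\<dots> \<le> ?C3 * min_height p K"
      using C3_ge[OF K] height[OF K] by (intro mult_right_mono) auto
    finally show ?thesis .
  qed
  then have "?C1\<^sup>2 * measure lebesgue \<Omega> \<le> ?C3\<^sup>2 * Theta \<T> p"
    unfolding vol[symmetric]
  proof (intro volume_le_Theta fin)
    show "K \<in> sets lebesgue" if "K \<in> \<T>" for K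
      using simplices[OF that] by (intro fmeasurableD lmeasurable_compact compact_simplex)
  qed (use C1_pos height in \<open>auto intro: less_imp_le\<close>)
  then have "sqrt (?C1\<^sup>2 * measure lebesgue \<Omega>) \<le> sqrt (?C3\<^sup>2 * Theta \<T> p)"
    by (rule real_sqrt_le_mono)
  then have volume: "sqrt (measure lebesgue \<Omega>) \<le> ?C3 * sqrt (Theta \<T> p) / ?C1"
    using C1_pos C3_pos by (simp add: real_sqrt_mult pos_le_divide_eq mult.commute)
  have "Kref \<noteq> {}"
    using assms(7) DIM_positive[where 'a = 'a] unfolding lagrange_basis_def by auto
  then obtain y where y: "y \<in> Kref"
    by blast
  have \<Lambda>: "0 \<le> ?\<Lambda>"
    by (rule order_trans[OF _ lebesgue_constant_upper[OF assms(7) y]]) (simp add: sum_nonneg)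
  have pw: "\<exists>q. poly_deg_le k q \<and> (\<forall>x \<in> interior K. fs x \<bullet> b = q x)"
    if "K \<in> \<T>" "b \<in> Basis" for K b
    using assms(12) that unfolding piecewise_best_approximation_def by blast
  let ?C = "(1 + ?\<Lambda>) * ?C3 * sqrt (Theta \<T> p) / ?C1"
  have C: "(1 + ?\<Lambda>) * sqrt (measure lebesgue \<Omega>) \<le> ?C"
    using mult_left_mono[OF volume, of "1 + ?\<Lambda>"] \<Lambda> by (simp add: mult.assoc)
  show ?thesis
  proof (cases "linf_norm \<Omega> (\<lambda>x. f x - fs x)")
    case (real M)
    have "l2_norm \<Omega> (\<lambda>x. f x - fh x) \<le> ennreal (sqrt (measure lebesgue \<Omega>) * ((1 + ?\<Lambda>) * M))"
      using assms(9) unfolding L2_field_def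
      by (intro linf_interpolation_bound_to_l2[OF assms(1) S assms(3,7,8) _ assms(10,11) pw] real \<Lambda>) auto
    also have "\<dots> \<le> ennreal (?C * M)"
      using mult_right_mono[OF C real(1)] by (intro ennreal_leI) (simp add: mult_ac)
    also have "\<dots> = ennreal ?C * ennreal M"
      using real(1) by (rule ennreal_mult'')
    finally show ?thesis
      using real(2) by simp
  next
    case top
    (* The right-hand side is then infinite: its constant factor is positive, and not 0 * \<infinity> = 0. *)
    have "\<not> negligible \<Omega>"
      using interior interior_subset open_not_negligible[OF open_interior] negligible_subset by metis
    then have "0 < measure lebesgue \<Omega>"
      using negligible_iff_measure0[OF \<Omega>_meas] by (simp add: less_le)
    then have "0 < (1 + ?\<Lambda>) * sqrt (measure lebesgue \<Omega>)"
      using \<Lambda> by simp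
    then have "0 < ?C"
      using C by linarith
    then have "ennreal ?C \<noteq> 0"
      by (simp only: ennreal_eq_0_iff not_le)
    then have "ennreal ?C * linf_norm \<Omega> (\<lambda>x. f x - fs x) = top"
      unfolding top ennreal_mult_top by (simp only: if_False)
    then show ?thesis
      by (simp only: top_greatest)
  qed
qed

end
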